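(* Let $h\ge k\ge 0$ be integers and let $x_0,\dots,x_k$ be nonnegative real numbers with $x_0+\cdots+x_k=1$ and $x_0>0$. The stationary distribution $\pi$ of the Multivariate Juggling Markov Chain on $\mathrm{St}_{h,k}$ with parameters $x_0,\dots,x_k$ is given, for $B=b_1\cdots b_h\in \mathrm{St}_{h,k}$, by $$\pi(B)=\frac{1}{Z_{h,k}}\prod_{\substack{i\in\{1,\dots,h\}\\ b_i=\bullet}}\left(x_{E_i(B)}+\cdots+x_k\right),$$ where $E_i(B)=\#\{j<i : b_j=\circ\}$ and where $Z_{h,k}=Z_{h,k}(x_0,\dots,x_k)$ is the constant determined by the condition that $\pi$ be a probability distribution.
   Context: $\mathrm{St}_h$ is the set of words of length $h$ on the alphabet $\{\bullet,\circ\}$, and $\mathrm{St}_{h,k}\subset \mathrm{St}_h$ is the subset of words containing exactly $k$ occurrences of $\circ$. For $A\in \mathrm{St}_{h,k+1}$ and $i\in\{0,\dots,k\}$, $T_i(A)\in \mathrm{St}_{h,k}$ is the word obtained by replacing the $(i+1)$-th occurrence of $\circ$ in $A$ (read from the left) by $\bullet$. The Multivariate Juggling Markov Chain (MJMC) is the Markov chain on $\mathrm{St}_{h,k}$ whose transition probability from $A=a_1a_2\cdots a_h$ to $B$ is $$P_{A,B}=\begin{cases}1 & \text{if } a_1=\circ \text{ and } B=a_2\cdots a_h\circ,\\ x_i & \text{if } a_1=\bullet \text{ and } B=T_i(a_2\cdots a_h\circ) \text{ for some } i\in\{0,\dots,k\},\\ 0&\text{otherwise.}\end{cases}$$ (For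 $h=0$ the only state is the empty word and the chain stays there.) *)

theory Defs
  imports "HOL-Probability.Probability_Mass_Function"
begin

datatype letter = Bullet | Circ

type_synonym word = "letter list"

definition St :: "nat \<Rightarrow> nat \<Rightarrow> word set" where
  "St h k = {A. length A = h \<and> count_list A Circ = k}"

definition circ_positions :: "word \<Rightarrow> nat list" where
  "circ_positions A = filter (\<lambda>p. A ! p = Circ) [0..<length A]"

text \<open>Since lists are indexed from 0, the \<open>(i+1)\<close>-th occurrence of \<open>Circ\<close> in \<open>A\<close> is at position
  \<open>circ_positions A ! i\<close>. This is meaningful only if \<open>A\<close> contains more than \<open>i\<close> letters \<open>Circ\<close>.\<close>

definition T :: "nat \<Rightarrow> word \<Rightarrow> word" where
  "T i A = A[circ_positions A ! i := Bullet]"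

lemma T_inj:
  assumes "i < count_list A Circ" "j < count_list A Circ" "T i A = T j A"
  shows "i = j"
proof -
  have len: "length (circ_positions A) = count_list A Circ"
  proof -
    have "length (circ_positions A) = card (set (circ_positions A))"
      by (rule distinct_card[symmetric]) (simp add: circ_positions_def)
    also have "set (circ_positions A) = {p. p < length A \<and> Circ = A ! p}"
      by (auto simp: circ_positions_def)
    also have "card \<dots> = count_list A Circ"
      by (simp only: count_list_eq_length_filter length_filter_conv_card)
    finally show ?thesis .
  qed
  have dist: "distinct (circ_positions A)"
    by (simp add: circ_positions_def)
  have pos: "circ_positions A ! i < length A \<and> A ! (circ_positions A ! i) = Circ"
    if "i < count_list A Circ" for i
  proof -
    have "circ_positions A ! i \<in> set (circ_positions A)"
      using that len by simp
    then show ?thesis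
      by (simp add: circ_positions_def)
  qed
  have "circ_positions A ! i = circ_positions A ! j"
  proof (rule ccontr)
    assume "circ_positions A ! i \<noteq> circ_positions A ! j"
    then have "T j A ! (circ_positions A ! i) = Circ"
      using pos[OF assms(1)] by (simp add: T_def)
    moreover have "T i A ! (circ_positions A ! i) = Bullet"
      using pos[OF assms(1)] by (simp add: T_def)
    ultimately show False
      using assms(3) by simp
  qed
  then show ?thesis
    using assms dist len by (simp add: nth_eq_iff_index_eq)
qed

text \<open>In the last equation \<open>A @ [Circ]\<close> has \<open>k + 1\<close> letters \<open>Circ\<close> when \<open>Bullet # A \<in> St h k\<close>, so
  by \<open>T_inj\<close> the index \<open>i\<close> is unique. The first equation only matters for \<open>h = 0\<close>.\<close>

fun mjmc_trans :: "nat \<Rightarrow> (nat \<Rightarrow> real) \<Rightarrow> word \<Rightarrow> word \<Rightarrow> real" where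
  "mjmc_trans k x [] B = (if B = [] then 1 else 0)"
| "mjmc_trans k x (Circ # A) B = (if B = A @ [Circ] then 1 else 0)"
| "mjmc_trans k x (Bullet # A) B =
     (if \<exists>i\<le>k. B = T i (A @ [Circ]) then x (THE i. i \<le> k \<and> B = T i (A @ [Circ])) else 0)"

text \<open>A probability distribution on \<open>S\<close> is a \<open>pmf\<close> supported in \<open>S\<close>. The state space \<open>S\<close> is meant
  to be finite.\<close>

definition stationary_distribution :: "'a set \<Rightarrow> ('a \<Rightarrow> 'a \<Rightarrow> real) \<Rightarrow> 'a pmf \<Rightarrow> bool" where
  "stationary_distribution S P \<pi> \<longleftrightarrow>
     set_pmf \<pi> \<subseteq> S \<and> (\<forall>B\<in>S. (\<Sum>A\<in>S. pmf \<pi> A * P A B) = pmf \<pi> B)"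

text \<open>Positions are counted from 0 here: \<open>E B i\<close> counts the letters \<open>Circ\<close> to the left of the
  \<open>(i+1)\<close>-th letter of \<open>B\<close>.\<close>

definition E :: "word \<Rightarrow> nat \<Rightarrow> nat" where
  "E B i = card {j. j < i \<and> B ! j = Circ}"

definition mjmc_weight :: "nat \<Rightarrow> (nat \<Rightarrow> real) \<Rightarrow> word \<Rightarrow> real" where
  "mjmc_weight k x B = (\<Prod>i\<in>{i. i < length B \<and> B ! i = Bullet}. \<Sum>j=E B i..k. x j)"

definition Z :: "nat \<Rightarrow> nat \<Rightarrow> (nat \<Rightarrow> real) \<Rightarrow> real" where
  "Z h k x = (\<Sum>B\<in>St h k. mjmc_weight k x B)"

lemma Z_normalizing:
  assumes "Z h k x \<noteq> 0"
  shows "(\<Sum>B\<in>St h k. 1 / c * mjmc_weight k x B) = 1 \<longleftrightarrow> c = Z h k x"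
proof -
  have "(\<Sum>B\<in>St h k. 1 / c * mjmc_weight k x B) = 1 / c * Z h k x"
    by (simp add: Z_def sum_distrib_left)
  then show ?thesis
    using assms by (cases "c = 0") (auto simp: field_simps)
qed

end

theory Submission
  imports Defs
begin

text \<open>
  Stationarity of the weights is proved by induction on the word from the left. The induction
  needs a parameter \<open>j\<close>, the number of letters \<open>Circ\<close> already read, and with the tail sums
  \<open>y j = x j + \<dots> + x k\<close> it comes down to \<open>y j = x j + y (j + 1)\<close>.

  For uniqueness, the positive and the negative part of the difference of two stationary
  distributions are again invariant, and their supports are disjoint and closed under transitions.
  But a chain that always applies \<open>T 0\<close> moves \<open>Bullet\<^sup>a Circ W\<close> to \<open>Bullet\<^sup>a W Circ\<close>, so that
  \<open>Bullet\<^sup>h\<^sup>-\<^sup>k Circ\<^sup>k\<close> can be reached from every state. Hence one of the two parts vanishes, and then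
  so does the other, both having the same mass.
\<close>

section \<open>Uniqueness of stationary distributions\<close>

text \<open>One application of \<open>P\<close> can only enlarge the positive part at each point,
  since its image dominates both \<open>d B\<close> and 0. It cannot enlarge the total mass, as rows
  sum to at most 1. So the nonnegative gaps have sum zero and all vanish.\<close>

lemma invariant_pos_part:
  fixes P :: "'a \<Rightarrow> 'a \<Rightarrow> real" and d :: "'a \<Rightarrow> real"
  assumes fin: "finite S"
    and nonneg: "\<And>A B. A \<in> S \<Longrightarrow> B \<in> S \<Longrightarrow> 0 \<le> P A B"
    and row: "\<And>A. A \<in> S \<Longrightarrow> (\<Sum>B\<in>S. P A B) \<le> 1"
    and inv: "\<And>B. B \<in> S \<Longrightarrow> (\<Sum>A\<in>S. d A * P A B) = d B"
    and B: "B \<in> S"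
  shows "(\<Sum>A\<in>S. max 0 (d A) * P A B) = max 0 (d B)"
proof -
  let ?p = "\<lambda>A. max 0 (d A)"
  let ?gap = "\<lambda>B. (\<Sum>A\<in>S. ?p A * P A B) - ?p B"
  have gap: "0 \<le> ?gap B" if "B \<in> S" for B
  proof -
    have "d B \<le> (\<Sum>A\<in>S. ?p A * P A B)"
      unfolding inv[OF that, symmetric]
      by (intro sum_mono mult_right_mono nonneg that) auto
    moreover have "0 \<le> (\<Sum>A\<in>S. ?p A * P A B)"
      by (intro sum_nonneg mult_nonneg_nonneg nonneg that) auto
    ultimately show ?thesis by simp
  qed
  have "(\<Sum>B\<in>S. \<Sum>A\<in>S. ?p A * P A B) = (\<Sum>A\<in>S. ?p A * (\<Sum>B\<in>S. P A B))"
    by (subst sum.swap) (simp add: sum_distrib_left)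
  also have "\<dots> \<le> (\<Sum>A\<in>S. ?p A * 1)"
    by (intro sum_mono mult_left_mono row) auto
  finally have "(\<Sum>B\<in>S. ?gap B) \<le> 0"
    by (simp add: sum_subtractf)
  then have "(\<Sum>B\<in>S. ?gap B) = 0"
    using gap by (meson order_antisym sum_nonneg)
  then have "?gap B = 0"
    using sum_nonneg_eq_0_iff[of S ?gap] fin gap B by blast
  then show ?thesis by simp
qed

text \<open>Positivity spreads along every transition, because the invariant value at the target is
  at least the single term \<open>p B * P B C\<close>.\<close>

lemma invariant_pos_reachable:
  fixes P :: "'a \<Rightarrow> 'a \<Rightarrow> real" and p :: "'a \<Rightarrow> real"
  assumes fin: "finite S"
    and nonneg: "\<And>A B. A \<in> S \<Longrightarrow> B \<in> S \<Longrightarrow> 0 \<le> P A B"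
    and p: "\<And>A. A \<in> S \<Longrightarrow> 0 \<le> p A"
    and inv: "\<And>B. B \<in> S \<Longrightarrow> (\<Sum>A\<in>S. p A * P A B) = p B"
    and reach: "(A, g) \<in> {(A, B). A \<in> S \<and> B \<in> S \<and> 0 < P A B}\<^sup>*"
    and pos: "0 < p A"
  shows "0 < p g"
  using reach
proof (induction rule: rtrancl_induct)
  case base
  show ?case by (rule pos)
next
  case (step B C)
  then have B: "B \<in> S" and C: "C \<in> S" and "0 < P B C" by auto
  then have "0 < p B * P B C" using step.IH by simp
  also have "\<dots> \<le> (\<Sum>A\<in>S. p A * P A C)"
    using fin B C by (intro member_le_sum mult_nonneg_nonneg p nonneg) auto
  finally show ?case using inv[OF C] by simp
qed

lemma stationary_distribution_unique:
  assumes fin: "finite S"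
    and nonneg: "\<And>A B. A \<in> S \<Longrightarrow> B \<in> S \<Longrightarrow> 0 \<le> P A B"
    and row: "\<And>A. A \<in> S \<Longrightarrow> (\<Sum>B\<in>S. P A B) \<le> 1"
    and reach: "\<And>A. A \<in> S \<Longrightarrow> (A, g) \<in> {(A, B). A \<in> S \<and> B \<in> S \<and> 0 < P A B}\<^sup>*"
    and st: "stationary_distribution S P \<pi>" "stationary_distribution S P \<rho>"
  shows "\<pi> = \<rho>"
proof -
  define d where "d A = pmf \<pi> A - pmf \<rho> A" for A
  have inv: "(\<Sum>A\<in>S. d A * P A B) = d B" if "B \<in> S" for B
    using st that by (simp add: stationary_distribution_def d_def left_diff_distrib sum_subtractf)
  have inv': "(\<Sum>A\<in>S. - d A * P A B) = - d B" if "B \<in> S" for B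
    using inv[OF that] by (simp add: sum_negf)
  have "sum (pmf \<pi>) S = 1" "sum (pmf \<rho>) S = 1"
    using st fin by (auto simp: stationary_distribution_def intro!: sum_pmf_eq_1)
  then have sum0: "sum d S = 0"
    by (simp add: d_def sum_subtractf)
  have pos_part: "0 < e g"
    if e: "\<And>B. B \<in> S \<Longrightarrow> (\<Sum>A\<in>S. e A * P A B) = e B" and A: "A \<in> S" "0 < e A" for e A
  proof -
    have "(\<Sum>A\<in>S. max 0 (e A) * P A B) = max 0 (e B)" if "B \<in> S" for B
      using invariant_pos_part[of S P e B] fin nonneg row e that by blast
    then have "0 < max 0 (e g)"
      using A by (intro invariant_pos_reachable[OF fin _ _ _ reach] nonneg) auto
    then show ?thesis by simp
  qed
  have pos: "0 < d g" if "A \<in> S" "0 < d A" for A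
    using pos_part[of d] inv that by blast
  have neg: "d g < 0" if "A \<in> S" "d A < 0" for A
    using pos_part[of "\<lambda>A. - d A"] inv' that by force
  \<comment> \<open>The sign of \<open>d g\<close> excludes one sign of \<open>d\<close> on all of
    \<open>S\<close>. A function of constant sign with sum zero vanishes.\<close>
  have "d A = 0" if "A \<in> S" for A
  proof (cases "0 \<le> d g")
    case True
    then have "\<And>A. A \<in> S \<Longrightarrow> 0 \<le> d A" using neg by force
    then show ?thesis using sum_nonneg_eq_0_iff[of S d] fin sum0 that by blast
  next
    case False
    then have "\<And>A. A \<in> S \<Longrightarrow> 0 \<le> - d A" using pos by force
    then show ?thesis
      using sum_nonneg_eq_0_iff[of S "\<lambda>A. - d A"] fin sum0 that by (simp add: sum_negf)
  qed
  moreover have "d A = 0" if "A \<notin> S" for A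
  proof -
    have "A \<notin> set_pmf \<pi>" "A \<notin> set_pmf \<rho>"
      using st that by (auto simp: stationary_distribution_def)
    then show ?thesis by (simp add: d_def set_pmf_iff)
  qed
  ultimately show ?thesis
    by (intro pmf_eqI) (auto simp: d_def)
qed

section \<open>Words\<close>

lemma count_list_replicate: "count_list (replicate n a) b = (if a = b then n else 0)"
  by (induction n) auto

lemma finite_St: "finite (St h k)"
proof (rule finite_subset)
  show "St h k \<subseteq> {A. set A \<subseteq> {Bullet, Circ} \<and> length A = h}"
    using letter.exhaust by (auto simp: St_def)
qed (simp add: finite_lists_length_eq)

lemma Bullet_Cons_in_St [simp]: "Bullet # A \<in> St (Suc n) m \<longleftrightarrow> A \<in> St n m"
  by (simp add: St_def)

lemma Circ_Cons_in_St [simp]: "Circ # A \<in> St (Suc n) (Suc m) \<longleftrightarrow> A \<in> St n m"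
  by (simp add: St_def)

text \<open>The second sum ranges over a comprehension rather than \<open>St n (m - 1)\<close>, so
  that it is empty for \<open>m = 0\<close>.\<close>

lemma sum_St_Suc:
  fixes f :: "word \<Rightarrow> real"
  shows "sum f (St (Suc n) m) =
    (\<Sum>A\<in>St n m. f (Bullet # A)) + (\<Sum>A | Circ # A \<in> St (Suc n) m. f (Circ # A))"
proof -
  have fin: "finite (Cons Circ ` {A. Circ # A \<in> St (Suc n) m})"
    by (rule finite_subset[OF _ finite_St[of "Suc n" m]]) auto
  have "St (Suc n) m = Cons Bullet ` St n m \<union> Cons Circ ` {A. Circ # A \<in> St (Suc n) m}"
    (is "_ = ?L \<union> ?R")
  proof (intro equalityI subsetI)
    fix A assume A: "A \<in> St (Suc n) m"
    then obtain c A' where "A = c # A'" by (cases A) (auto simp: St_def)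
    with A show "A \<in> ?L \<union> ?R" by (cases c) auto
  qed auto
  then have "sum f (St (Suc n) m) = sum f (?L \<union> ?R)" by simp
  also have "\<dots> = sum f ?L + sum f ?R"
    using fin by (intro sum.union_disjoint) (auto simp: finite_St)
  finally show ?thesis
    by (simp add: sum.reindex)
qed

text \<open>Only \<open>A = butlast B\<close> can contribute. The constant \<open>c\<close> is 1 for
  the move from \<open>Circ # A\<close> in the balance equation, and \<open>x j\<close> when the
  induction for the weights meets a \<open>Circ\<close> that \<open>T 0\<close> erases.\<close>

lemma sum_Circ_snoc:
  fixes f :: "word \<Rightarrow> real"
  assumes B: "B \<in> St (Suc n) m"
  shows "(\<Sum>A | Circ # A \<in> St (Suc n) m. f A * (if B = A @ [Circ] then c else 0)) =
    (if last B = Circ then f (butlast B) * c else 0)"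
proof -
  have fin: "finite {A. Circ # A \<in> St (Suc n) m}"
    using finite_vimageI[OF finite_St[of "Suc n" m], of "Cons Circ"] by (simp add: vimage_def)
  have eq: "B = A @ [Circ] \<longleftrightarrow> last B = Circ \<and> A = butlast B" for A
    using B by (cases B rule: rev_cases) (auto simp: St_def)
  have mem: "Circ # butlast B \<in> St (Suc n) m" if "last B = Circ"
    using B that by (cases B rule: rev_cases) (auto simp: St_def)
  show ?thesis
    using fin mem by (auto simp: eq if_distrib[of "(*) _"] cong: if_cong)
qed

section \<open>Recursion on the first letter for \<open>circ_positions\<close>, \<open>T\<close> and
  \<open>E\<close>\<close>

lemma circ_positions_Cons:
  "circ_positions (c # A) = (if c = Circ then [0] else []) @ map Suc (circ_positions A)"
proof -
  have "[0..<Suc (length A)] = 0 # map Suc [0..<length A]"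
    by (simp add: upt_conv_Cons map_Suc_upt del: upt_Suc)
  then show ?thesis
    by (simp add: circ_positions_def filter_map o_def del: upt_Suc)
qed

lemma length_circ_positions: "length (circ_positions A) = count_list A Circ"
  by (induction A) (auto simp: circ_positions_Cons, simp add: circ_positions_def)

lemma T_Bullet_Cons: "i < count_list A Circ \<Longrightarrow> T i (Bullet # A) = Bullet # T i A"
  by (simp add: T_def circ_positions_Cons length_circ_positions)

lemma T_0_Circ_Cons: "T 0 (Circ # A) = Bullet # A"
  by (simp add: T_def circ_positions_Cons)

lemma T_Suc_Circ_Cons: "i < count_list A Circ \<Longrightarrow> T (Suc i) (Circ # A) = Circ # T i A"
  by (simp add: T_def circ_positions_Cons length_circ_positions)

lemma T_0_replicate_Bullet: "T 0 (replicate a Bullet @ Circ # A) = replicate a Bullet @ Bullet # A"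
  by (induction a) (simp_all add: T_0_Circ_Cons T_Bullet_Cons)

lemma E_Cons_Suc: "E (c # A) (Suc i) = (if c = Circ then 1 else 0) + E A i"
proof -
  have "{j. j < Suc i \<and> (c # A) ! j = Circ} =
      (if c = Circ then {0} else {}) \<union> Suc ` {j. j < i \<and> A ! j = Circ}"
    by (auto simp: less_Suc_eq_0_disj)
  then show ?thesis
    by (auto simp: E_def card_image card_insert_if)
qed

section \<open>Weights\<close>

text \<open>The weight of a word that is read after a prefix with \<open>j\<close> letters \<open>Circ\<close>.\<close>

definition shifted_weight :: "nat \<Rightarrow> (nat \<Rightarrow> real) \<Rightarrow> nat \<Rightarrow> word \<Rightarrow> real" where
  "shifted_weight k x j B =
     (\<Prod>i\<in>{i. i < length B \<and> B ! i = Bullet}. \<Sum>l=j + E B i..k. x l)"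

lemma mjmc_weight_eq: "mjmc_weight k x B = shifted_weight k x 0 B"
  by (simp add: mjmc_weight_def shifted_weight_def)

lemma shifted_weight_Nil [simp]: "shifted_weight k x j [] = 1"
  by (simp add: shifted_weight_def)

lemma shifted_weight_Circ [simp]:
  "shifted_weight k x j (Circ # B) = shifted_weight k x (Suc j) B"
proof -
  have "{i. i < length (Circ # B) \<and> (Circ # B) ! i = Bullet} =
      Suc ` {i. i < length B \<and> B ! i = Bullet}"
    by (auto simp: less_Suc_eq_0_disj)
  then show ?thesis
    by (simp add: shifted_weight_def prod.reindex E_Cons_Suc)
qed

lemma shifted_weight_Bullet [simp]:
  "shifted_weight k x j (Bullet # B) = (\<Sum>l=j..k. x l) * shifted_weight k x j B"
proof -
  have "{i. i < length (Bullet # B) \<and> (Bullet # B) ! i = Bullet} =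
      insert 0 (Suc ` {i. i < length B \<and> B ! i = Bullet})"
    by (auto simp: less_Suc_eq_0_disj)
  moreover have "E (Bullet # B) 0 = 0"
    by (simp add: E_def)
  ultimately show ?thesis
    by (simp add: shifted_weight_def prod.reindex E_Cons_Suc)
qed

text \<open>For \<open>j = 0\<close> this is the balance equation at \<open>B\<close>: the first
  summand comes from the predecessor \<open>Circ # butlast B\<close>, the sum from the predecessors
  \<open>Bullet # A\<close>, whose leading factor is the total sum 1. Removing a leading
  \<open>Circ\<close> raises \<open>j\<close> and lowers \<open>m\<close> by one, which preserves
  \<open>j + m = k\<close>.\<close>

lemma shifted_weight_recursion:
  assumes "B \<in> St (Suc n) m" and "j + m = k"
  shows "shifted_weight k x j B =
    (if last B = Circ then shifted_weight k x (Suc j) (butlast B) else 0) +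
    (\<Sum>A\<in>St n m. shifted_weight k x j A *
      (\<Sum>i\<le>m. if B = T i (A @ [Circ]) then x (j + i) else 0))"
  using assms
proof (induction n arbitrary: B m j)
  case 0
  then obtain c where c: "B = [c]"
    by (auto simp: St_def length_Suc_conv)
  have "St 0 m = (if m = 0 then {[]} else {})"
    by (auto simp: St_def)
  \<comment> \<open>For \<open>[Circ]\<close> both sides are 1, as \<open>St 0 1\<close> is empty.
    For \<open>[Bullet]\<close> the assumption gives \<open>j = k\<close>, and both sides are
    \<open>x k\<close>.\<close>
  moreover have "m = (if c = Circ then 1 else 0)"
    using 0 c by (auto simp: St_def)
  ultimately show ?case
    using 0 c by (cases c) (simp_all add: T_0_Circ_Cons)
next
  case (Suc n)
  from Suc.prems(1) obtain c C where B: "B = c # C" and C: "C \<noteq> []"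
    by (auto simp: St_def length_Suc_conv)
  let ?w = "shifted_weight k x"
  show ?case
  proof (cases c)
    case Circ
    with Suc.prems(1) B obtain m' where m: "m = Suc m'" and C': "C \<in> St (Suc n) m'"
      by (cases m) (auto simp: St_def)
    have bul: "(\<Sum>i\<le>m. if B = T i ((Bullet # A) @ [Circ]) then x (j + i) else 0) = 0"
      if "A \<in> St n m" for A
      using that by (intro sum.neutral) (auto simp: B Circ T_Bullet_Cons St_def)
    \<comment> \<open>Index 0 would turn the leading \<open>Circ\<close> into \<open>Bullet\<close>,
      so its term is zero. The remaining indices drop by one, which the larger offset
      \<open>Suc j\<close> makes up for.\<close>
    have circ: "(\<Sum>i\<le>m. if B = T i ((Circ # A) @ [Circ]) then x (j + i) else 0) =
        (\<Sum>i\<le>m'. if C = T i (A @ [Circ]) then x (Suc j + i) else 0)"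
      if "A \<in> St n m'" for A
      using that unfolding m sum.atMost_Suc_shift
      by (simp add: B Circ T_0_Circ_Cons) (intro sum.cong refl, auto simp: T_Suc_Circ_Cons St_def)
    have "?w j B = ?w (Suc j) C" by (simp add: B Circ)
    also have "\<dots> = (if last C = Circ then ?w (Suc (Suc j)) (butlast C) else 0) +
        (\<Sum>A\<in>St n m'. ?w (Suc j) A * (\<Sum>i\<le>m'. if C = T i (A @ [Circ]) then x (Suc j + i) else 0))"
      using Suc.prems(2) m by (intro Suc.IH C') simp
    also have "(if last C = Circ then ?w (Suc (Suc j)) (butlast C) else 0) =
        (if last B = Circ then ?w (Suc j) (butlast B) else 0)"
      using C by (simp add: B Circ)
    also have "(\<Sum>A\<in>St n m'. ?w (Suc j) A *
          (\<Sum>i\<le>m'. if C = T i (A @ [Circ]) then x (Suc j + i) else 0)) =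
        (\<Sum>A\<in>St (Suc n) m. ?w j A * (\<Sum>i\<le>m. if B = T i (A @ [Circ]) then x (j + i) else 0))"
      unfolding sum_St_Suc using bul circ by (simp add: m)
    finally show ?thesis .
  next
    case Bullet
    let ?y = "\<lambda>j. \<Sum>l=j..k. x l"
    let ?R = "\<Sum>A\<in>St n m. ?w j A * (\<Sum>i\<le>m. if C = T i (A @ [Circ]) then x (j + i) else 0)"
    let ?L = "if last C = Circ then ?w (Suc j) (butlast C) else 0"
    have C': "C \<in> St (Suc n) m"
      using Suc.prems(1) B Bullet by simp
    have bul: "(\<Sum>i\<le>m. if B = T i ((Bullet # A) @ [Circ]) then x (j + i) else 0) =
        (\<Sum>i\<le>m. if C = T i (A @ [Circ]) then x (j + i) else 0)"
      if "A \<in> St n m" for A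
      using that by (intro sum.cong) (auto simp: B Bullet T_Bullet_Cons St_def)
    \<comment> \<open>As \<open>B\<close> starts with \<open>Bullet\<close>, the leading
      \<open>Circ\<close> must be the letter replaced, so only index 0 can contribute.\<close>
    have circ: "(\<Sum>i\<le>m. if B = T i ((Circ # A) @ [Circ]) then x (j + i) else 0) =
        (if C = A @ [Circ] then x j else 0)"
      if A: "Circ # A \<in> St (Suc n) m" for A
    proof -
      obtain m' where m: "m = Suc m'" and "A \<in> St n m'"
        using A by (cases m) (auto simp: St_def)
      then have "\<not> B = T (Suc i) ((Circ # A) @ [Circ])" if "i \<le> m'" for i
        using that by (simp add: B Bullet T_Suc_Circ_Cons St_def)
      then show ?thesis
        unfolding m sum.atMost_Suc_shift by (simp add: B Bullet T_0_Circ_Cons)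
    qed
    have "(\<Sum>A\<in>St (Suc n) m. ?w j A * (\<Sum>i\<le>m. if B = T i (A @ [Circ]) then x (j + i) else 0)) =
        (\<Sum>A\<in>St n m. ?y j * (?w j A * (\<Sum>i\<le>m. if C = T i (A @ [Circ]) then x (j + i) else 0))) +
        (\<Sum>A | Circ # A \<in> St (Suc n) m. ?w (Suc j) A * (if C = A @ [Circ] then x j else 0))"
      unfolding sum_St_Suc using bul circ by (simp add: mult.assoc)
    also have "\<dots> = ?y j * ?R + ?L * x j"
      unfolding sum_Circ_snoc[OF C'] by (simp add: sum_distrib_left)
    finally have S: "(\<Sum>A\<in>St (Suc n) m. ?w j A *
        (\<Sum>i\<le>m. if B = T i (A @ [Circ]) then x (j + i) else 0)) = ?y j * ?R + ?L * x j" .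
    have L: "(if last B = Circ then ?w (Suc j) (butlast B) else 0) = ?y (Suc j) * ?L"
      using C by (simp add: B Bullet)
    \<comment> \<open>The induction hypothesis requires \<open>?L\<close> with coefficient
      \<open>?y j\<close>. The word \<open>butlast B\<close> supplies \<open>?y (Suc j)\<close>, and
      the words whose leading \<open>Circ\<close> is erased supply \<open>x j\<close>.\<close>
    have y: "?y j = x j + ?y (Suc j)"
      using Suc.prems(2) by (simp add: sum.atLeast_Suc_atMost)
    have "?w j B = ?y j * ?w j C"
      by (simp add: B Bullet)
    also have "?w j C = ?L + ?R"
      by (rule Suc.IH[OF C' Suc.prems(2)])
    also have "?y j * (?L + ?R) = ?y (Suc j) * ?L + (?y j * ?R + ?L * x j)"
      using y by (simp add: algebra_simps)
    finally show ?thesis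
      unfolding L S .
  qed
qed

section \<open>The juggling chain\<close>

text \<open>By \<open>T_inj\<close> at most one index satisfies the condition, so the definite
  description becomes a sum, which can be exchanged with sums over states.\<close>

lemma mjmc_trans_Bullet:
  assumes "count_list A Circ = k"
  shows "mjmc_trans k x (Bullet # A) B = (\<Sum>i\<le>k. if B = T i (A @ [Circ]) then x i else 0)"
proof (cases "\<exists>i\<le>k. B = T i (A @ [Circ])")
  case True
  then obtain i where i: "i \<le> k" "B = T i (A @ [Circ])" by blast
  have uniq: "l = i" if "l \<le> k" "B = T l (A @ [Circ])" for l
    using T_inj[of l "A @ [Circ]" i] that i assms by simp
  then have "(THE l. l \<le> k \<and> B = T l (A @ [Circ])) = i"
    using i by (intro the_equality) auto
  moreover have "(\<Sum>l\<le>k. if B = T l (A @ [Circ]) then x l else 0) = (\<Sum>l\<le>k. if l = i then x l else 0)"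
    using i uniq by (intro sum.cong) auto
  ultimately show ?thesis
    using True i(1) by simp
next
  case False
  then show ?thesis by auto
qed

lemma mjmc_trans_nonneg:
  assumes "A \<in> St h k" and "\<And>i. i \<le> k \<Longrightarrow> 0 \<le> x i"
  shows "0 \<le> mjmc_trans k x A B"
proof (cases "(k, x, A, B)" rule: mjmc_trans.cases)
  case (3 k x A B)
  then show ?thesis
    using assms by (auto simp: mjmc_trans_Bullet St_def simp del: mjmc_trans.simps intro!: sum_nonneg)
qed auto

text \<open>Each index has a single target, so after exchanging the sums it contributes at most
  \<open>x i\<close>. An upper bound is enough for the uniqueness argument and avoids checking that
  the targets lie in \<open>S\<close>.\<close>

lemma mjmc_trans_row_sum_le:
  assumes "finite S" and A: "A \<in> St h k" and x: "\<And>i. i \<le> k \<Longrightarrow> 0 \<le> x i" "(\<Sum>i=0..k. x i) = 1"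
  shows "(\<Sum>B\<in>S. mjmc_trans k x A B) \<le> 1"
proof (cases "(k, x, A, undefined :: word)" rule: mjmc_trans.cases)
  case (3 k' x' A' B')
  then have "A = Bullet # A'" by simp
  then have "(\<Sum>B\<in>S. mjmc_trans k x A B) = (\<Sum>i\<le>k. \<Sum>B\<in>S. if B = T i (A' @ [Circ]) then x i else 0)"
    using A by (subst sum.swap) (simp add: mjmc_trans_Bullet St_def del: mjmc_trans.simps)
  also have "\<dots> \<le> (\<Sum>i\<le>k. x i)"
    using x(1) \<open>finite S\<close> by (intro sum_mono) auto
  finally show ?thesis
    using x(2) by (simp add: atMost_atLeast0)
qed (use \<open>finite S\<close> in auto)

text \<open>Induction on the unsorted middle part \<open>W\<close>. A leading \<open>Bullet\<close>
  of \<open>W\<close> joins the left block without any move. A leading \<open>Circ\<close> passes to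
  the right block in one transition, of probability 1 if the left block is empty and
  \<open>x 0\<close> otherwise.\<close>

lemma mjmc_reach_ground:
  assumes "replicate a Bullet @ W @ replicate c Circ \<in> St h k" and "0 < x 0"
  shows "(replicate a Bullet @ W @ replicate c Circ, replicate (h - k) Bullet @ replicate k Circ)
    \<in> {(A, B). A \<in> St h k \<and> B \<in> St h k \<and> 0 < mjmc_trans k x A B}\<^sup>*"
  using assms(1)
proof (induction W arbitrary: a c)
  case Nil
  then have "c = k" "a = h - k" by (auto simp: St_def count_list_replicate)
  then show ?case by simp
next
  case (Cons b W)
  show ?case
  proof (cases b)
    case Bullet
    then show ?thesis
      using Cons.IH[of "Suc a" c] Cons.prems by (simp add: replicate_app_Cons_same)
  next
    case Circ
    let ?A = "replicate a Bullet @ (b # W) @ replicate c Circ"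
    let ?B = "replicate a Bullet @ W @ replicate (Suc c) Circ"
    have snoc: "replicate c Circ @ [Circ] = replicate (Suc c) Circ"
      by (simp add: replicate_append_same)
    have B: "?B \<in> St h k"
      using Cons.prems by (simp add: Circ St_def)
    have "0 < mjmc_trans k x ?A ?B"
    proof (cases a)
      case 0
      then show ?thesis by (simp add: Circ replicate_append_same)
    next
      case (Suc a')
      let ?A' = "replicate a' Bullet @ Circ # W @ replicate c Circ"
      have A: "?A = Bullet # ?A'" by (simp add: Suc Circ)
      \<comment> \<open>The \<open>Bullet\<close> lost at the front is restored by the one that
        \<open>T 0\<close> writes over the first \<open>Circ\<close>, so the left block keeps its
        length.\<close>
      have T: "?B = T 0 (?A' @ [Circ])"
        using T_0_replicate_Bullet[of a' "W @ replicate c Circ @ [Circ]"]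
        by (simp add: Suc snoc replicate_app_Cons_same)
      have cnt: "count_list ?A' Circ = k"
        using Cons.prems unfolding A by (simp add: St_def)
      have "(THE i. i \<le> k \<and> ?B = T i (?A' @ [Circ])) = 0"
      proof (rule the_equality)
        fix i
        assume "i \<le> k \<and> ?B = T i (?A' @ [Circ])"
        then show "i = 0"
          using T T_inj[of i "?A' @ [Circ]" 0] cnt
          by (metis count_list_append count_list.simps less_Suc_eq_le add.right_neutral
              add_Suc_right zero_less_Suc Suc_eq_plus1)
      qed (use T in simp)
      moreover have "\<exists>i\<le>k. ?B = T i (?A' @ [Circ])"
        using T by blast
      ultimately show ?thesis
        unfolding A mjmc_trans.simps using assms(2) by (simp only: if_True)
    qed
    then have "(?A, ?B) \<in> {(A, B). A \<in> St h k \<and> B \<in> St h k \<and> 0 < mjmc_trans k x A B}"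
      using B Cons.prems by simp
    then show ?thesis
      using Cons.IH[OF B] by (rule converse_rtrancl_into_rtrancl)
  qed
qed

text \<open>Splitting the states by their first letter yields
  \<open>shifted_weight_recursion\<close> with \<open>j = 0\<close> and \<open>m = k\<close>. That
  recursion concerns nonempty words, so \<open>h = 0\<close> is treated apart.\<close>

lemma mjmc_weight_invariant:
  assumes B: "B \<in> St h k" and x: "(\<Sum>i=0..k. x i) = 1"
  shows "(\<Sum>A\<in>St h k. mjmc_weight k x A * mjmc_trans k x A B) = mjmc_weight k x B"
proof (cases h)
  case 0
  then have "B = []" "St h k = {[]}"
    using B by (auto simp: St_def)
  then show ?thesis by simp
next
  case (Suc n)
  let ?w = "shifted_weight k x"
  have B': "B \<in> St (Suc n) k" using B Suc by simp
  have "(\<Sum>A\<in>St h k. mjmc_weight k x A * mjmc_trans k x A B) =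
      (\<Sum>A\<in>St n k. ?w 0 A * (\<Sum>i\<le>k. if B = T i (A @ [Circ]) then x i else 0)) +
      (\<Sum>A | Circ # A \<in> St (Suc n) k. ?w (Suc 0) A * (if B = A @ [Circ] then 1 else 0))"
    unfolding Suc sum_St_Suc mjmc_weight_eq
    by (intro arg_cong2[of _ _ _ _ "(+)"] sum.cong)
      (auto simp: x mjmc_trans_Bullet St_def simp del: mjmc_trans.simps(3))
  also have "\<dots> = ?w 0 B"
    unfolding sum_Circ_snoc[OF B']
    using shifted_weight_recursion[OF B', of 0 k x] by (simp add: cong: if_cong)
  finally show ?thesis
    by (simp add: mjmc_weight_eq)
qed

lemma mjmc_weight_nonneg:
  assumes "\<And>i. i \<le> k \<Longrightarrow> 0 \<le> x i"
  shows "0 \<le> mjmc_weight k x B"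
  unfolding mjmc_weight_def using assms by (intro prod_nonneg sum_nonneg) auto

text \<open>Some weights may vanish, but in the word with all letters \<open>Bullet\<close> in front
  every factor is the full sum 1, so its weight is 1.\<close>

lemma Z_pos:
  assumes "k \<le> h" and "\<And>i. i \<le> k \<Longrightarrow> 0 \<le> x i" and "(\<Sum>i=0..k. x i) = 1"
  shows "0 < Z h k x"
proof -
  let ?g = "replicate (h - k) Bullet @ replicate k Circ"
  have "shifted_weight k x j (replicate n Circ) = 1" for j n
    by (induction n arbitrary: j) auto
  then have "shifted_weight k x 0 (replicate n Bullet @ replicate k Circ) = 1" for n
    using assms(3) by (induction n) auto
  then have "0 < mjmc_weight k x ?g"
    by (simp add: mjmc_weight_eq)
  also have "\<dots> \<le> Z h k x"
    unfolding Z_def using assms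
    by (intro member_le_sum mjmc_weight_nonneg finite_St) (auto simp: St_def count_list_replicate)
  finally show ?thesis .
qed

lemma mjmc_weight_stationary:
  assumes "k \<le> h" and "\<And>i. i \<le> k \<Longrightarrow> 0 \<le> x i" and "(\<Sum>i=0..k. x i) = 1"
  obtains \<pi> where "stationary_distribution (St h k) (mjmc_trans k x) \<pi>"
    and "\<And>B. B \<in> St h k \<Longrightarrow> pmf \<pi> B = 1 / Z h k x * mjmc_weight k x B"
proof -
  note Z = Z_pos[OF assms]
  \<comment> \<open>A \<open>pmf\<close> lives on the whole type of words, so the normalised weights
    are extended by zero. The integral over all words then reduces to a finite sum.\<close>
  define f where "f B = (if B \<in> St h k then 1 / Z h k x * mjmc_weight k x B else 0)" for B
  have f: "0 \<le> f B" for B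
    using Z assms(2) by (simp add: f_def mjmc_weight_nonneg)
  have "(\<Sum>B\<in>St h k. f B) = 1"
    using Z_normalizing[of h k x "Z h k x"] Z by (simp add: f_def)
  moreover have "(\<integral>\<^sup>+B. ennreal (f B) \<partial>count_space UNIV) = (\<Sum>B\<in>St h k. ennreal (f B))"
    by (rule nn_integral_count_space') (auto simp: finite_St f_def)
  ultimately have "(\<integral>\<^sup>+B. ennreal (f B) \<partial>count_space UNIV) = 1"
    using f by (simp add: sum_ennreal)
  then have pmf: "pmf (embed_pmf f) = f"
    using f by (intro ext pmf_embed_pmf) auto
  show ?thesis
  proof (rule that)
    show "stationary_distribution (St h k) (mjmc_trans k x) (embed_pmf f)"
      unfolding stationary_distribution_def
    proof (intro conjI ballI subsetI)
      show "B \<in> St h k" if "B \<in> set_pmf (embed_pmf f)" for B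
        using that by (auto simp: set_pmf_iff pmf f_def split: if_splits)
    next
      fix B assume B: "B \<in> St h k"
      show "(\<Sum>A\<in>St h k. pmf (embed_pmf f) A * mjmc_trans k x A B) = pmf (embed_pmf f) B"
        using mjmc_weight_invariant[OF B assms(3)] B
        by (simp add: pmf f_def flip: sum_divide_distrib)
    qed
  qed (simp add: pmf f_def)
qed

theorem theorem2p5:
  fixes h k :: nat and x :: "nat \<Rightarrow> real"
  assumes "k \<le> h"
    and "\<And>i. i \<le> k \<Longrightarrow> 0 \<le> x i"
    and "(\<Sum>i=0..k. x i) = 1"
    and "0 < x 0"
  shows "(\<exists>!\<pi>. stationary_distribution (St h k) (mjmc_trans k x) \<pi>) \<and>
    (\<forall>\<pi>. stationary_distribution (St h k) (mjmc_trans k x) \<pi> \<longrightarrow>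
      (\<forall>B\<in>St h k. pmf \<pi> B = 1 / Z h k x * mjmc_weight k x B))"
proof -
  obtain \<pi> where \<pi>: "stationary_distribution (St h k) (mjmc_trans k x) \<pi>"
    and weight: "\<And>B. B \<in> St h k \<Longrightarrow> pmf \<pi> B = 1 / Z h k x * mjmc_weight k x B"
    using mjmc_weight_stationary[OF assms(1-3)] by blast
  have "\<rho> = \<pi>" if "stationary_distribution (St h k) (mjmc_trans k x) \<rho>" for \<rho>
  proof (rule stationary_distribution_unique[OF finite_St _ _ _ that \<pi>])
    fix A assume A: "A \<in> St h k"
    show "0 \<le> mjmc_trans k x A B" for B
      using mjmc_trans_nonneg[OF A assms(2)] .
    show "(\<Sum>B\<in>St h k. mjmc_trans k x A B) \<le> 1"
      using mjmc_trans_row_sum_le[OF finite_St A assms(2,3)] .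
    show "(A, replicate (h - k) Bullet @ replicate k Circ)
        \<in> {(A, B). A \<in> St h k \<and> B \<in> St h k \<and> 0 < mjmc_trans k x A B}\<^sup>*"
      \<comment> \<open>With both outer blocks empty the middle part is \<open>A\<close>
        itself.\<close>
      using mjmc_reach_ground[of 0 A 0 h k x] A assms(4) by simp
  qed
  with \<pi> weight show ?thesis by blast
qed

end
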